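(* (a) Assume that $s$ is concave on $\mathbb R^\sigma$. Then for all $u\in\operatorname{dom}\partial s$, $\mathcal E^u\subset\mathcal E_\beta$ for some $\beta\in\partial s(u)$. (b) Assume that $\operatorname{dom}s=\operatorname{dom}s^{**}$ and that for all $u\in\operatorname{dom}s$ there exists $\beta\in\mathbb R^\sigma$ such that $\mathcal E^u\subset\mathcal E_\beta$. Then $s$ is concave on $\mathbb R^\sigma$. (c) Assume that $\operatorname{dom}s=\operatorname{dom}s^{**}=\operatorname{dom}\partial s^{**}$. Then $s$ is concave on $\mathbb R^\sigma$ (thermodynamic equivalence of ensembles) if and only if the ensembles are equivalent at the level of equilibrium macrostates, i.e. for every $u\in\operatorname{dom}s$ there exists $\beta\in\mathbb R^\sigma$ such that $\mathcal E^u\subset\mathcal E_\beta$.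
   Context: Setting. For each $n\in\mathbb N$, $(\Omega_n,\mathcal F_n,P_n)$ is a probability space; $\sigma\ge1$ is an integer; $H_{n,1},\dots,H_{n,\sigma}:\Omega_n\to\mathbb R$ are bounded measurable functions; $a_n>0$ with $a_n\to\infty$. $\mathcal X$ is a Polish space, $Y_n:\Omega_n\to\mathcal X$ are random variables, and $\tilde H_1,\dots,\tilde H_\sigma:\mathcal X\to\mathbb R$ are bounded continuous functions such that $\lim_{n\to\infty}\sup_{\omega\in\Omega_n}|H_{n,i}(\omega)-\tilde H_i(Y_n(\omega))|=0$ for each $i$; $\tilde H:=(\tilde H_1,\dots,\tilde H_\sigma)$. With respect to $P_n$, $Y_n$ satisfies the large deviation principle on $\mathcal X$ with scaling constants $a_n$ and rate function $I:\mathcal X\to[0,\infty]$, where rate functions have compact level sets $\{I\le M\}$, $0\le M<\infty$ (in particular $\inf_{\mathcal X}I=0$). $\langle\cdot,\cdot\rangle$ is the Euclidean inner product. Definitions. Microcanonical entropy: $s(u):=-\inf\{I(x):x\in\mathcal X,\ \tilde H(x)=u\}\in[-\infty,0]$ for $u\in\mathbb R^\sigma$ (with $\inf\emptyset=\infty$); $\operatorname{dom}s:=\{u: s(u)>-\infty\}$; $s$ is upper semicontinuous, and concavity is meant in the extended-real-valued sense. Canonical free energy: $\varphi(\beta):=\inf_{x\in\mathcal X}\{\langle\beta,\tilde H(x)\rangle+I(x)\}=\inf_{u\in\mathbb R^\sigma}\{\langle\beta,u\rangle-s(u)\}$. $s^{**}(u):=\inf_{\beta\in\mathbb R^\sigma}\{\langle\beta,u\rangle-\varphi(\beta)\}$;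 $\operatorname{dom}s^{**}:=\{u:s^{**}(u)>-\infty\}$. For $f=s^{**}$, or $f=s$ when $s$ is concave, and $u\in\operatorname{dom}f$, the superdifferential $\partial f(u)$ is the set of $\beta\in\mathbb R^\sigma$ with $f(w)\le f(u)+\langle\beta,w-u\rangle$ for all $w\in\mathbb R^\sigma$; it is empty for $u\notin\operatorname{dom}f$; $\operatorname{dom}\partial f:=\{u:\partial f(u)\ne\emptyset\}$. Canonical equilibrium macrostates: $\mathcal E_\beta:=\{x\in\mathcal X: I(x)+\langle\beta,\tilde H(x)\rangle=\varphi(\beta)\}$, $\beta\in\mathbb R^\sigma$. Microcanonical equilibrium macrostates: $\mathcal E^u:=\{x\in\mathcal X:\tilde H(x)=u,\ I(x)=-s(u)\}$ for $u\in\operatorname{dom}s$, and $\mathcal E^u:=\emptyset$ for $u\notin\operatorname{dom}s$. *)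

theory Defs
  imports "HOL-Probability.Probability"
begin

text \<open>
  Logarithm on \<open>[0, \<infinity>)\<close> with \<open>log 0 = -\<infinity>\<close>; the library's real \<open>ln\<close> has \<open>ln 0 = 0\<close>, which
  would make the large deviation upper bound wrong for null events.
\<close>
definition eln :: "real \<Rightarrow> ereal" where
  "eln p = (if p \<le> 0 then -\<infinity> else ereal (ln p))"

text \<open>
  Lower semicontinuity is not listed separately: compact level sets are closed in a Hausdorff
  space.
\<close>
definition rate_function :: "('x::topological_space \<Rightarrow> ereal) \<Rightarrow> bool" where
  "rate_function I \<longleftrightarrow>
     (\<forall>x. 0 \<le> I x) \<and> (\<forall>M::real. 0 \<le> M \<longrightarrow> compact {x. I x \<le> ereal M})"

definition large_deviation_principle ::
    "(nat \<Rightarrow> 'w measure) \<Rightarrow> (nat \<Rightarrow> 'w \<Rightarrow> 'x::topological_space) \<Rightarrow> (nat \<Rightarrow> real) \<Rightarrow> ('x \<Rightarrow> ereal) \<Rightarrow> bool"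
  where
  "large_deviation_principle P Y a I \<longleftrightarrow>
     rate_function I \<and>
     (\<forall>F. closed F \<longrightarrow>
        limsup (\<lambda>n. ereal (1 / a n) * eln (measure (P n) {\<omega> \<in> space (P n). Y n \<omega> \<in> F}))
          \<le> - (INF x\<in>F. I x)) \<and>
     (\<forall>G. open G \<longrightarrow>
        - (INF x\<in>G. I x)
          \<le> liminf (\<lambda>n. ereal (1 / a n) * eln (measure (P n) {\<omega> \<in> space (P n). Y n \<omega> \<in> G})))"

text \<open>
  Below, \<open>h :: 'x \<Rightarrow> real ^ 's\<close> is the vector of the representation functions
  \<open>H~\<^sub>1, \<dots>, H~\<^sub>\<sigma>\<close>, with \<open>\<sigma> = CARD('s)\<close>. An infimum over the empty set is \<open>\<infinity>\<close> in \<open>ereal\<close>.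
\<close>

definition micro_entropy :: "('x \<Rightarrow> ereal) \<Rightarrow> ('x \<Rightarrow> real ^ 's) \<Rightarrow> real ^ 's \<Rightarrow> ereal" where
  "micro_entropy I h u = - (INF x\<in>{x. h x = u}. I x)"

definition free_energy :: "('x \<Rightarrow> ereal) \<Rightarrow> ('x \<Rightarrow> real ^ 's) \<Rightarrow> real ^ 's \<Rightarrow> ereal" where
  "free_energy I h \<beta> = (INF x. ereal (\<beta> \<bullet> h x) + I x)"

text \<open>The function \<open>s\<^sup>*\<^sup>*\<close>.\<close>
definition entropy_hull :: "('x \<Rightarrow> ereal) \<Rightarrow> ('x \<Rightarrow> real ^ 's) \<Rightarrow> real ^ 's \<Rightarrow> ereal" where
  "entropy_hull I h u = (INF \<beta>. ereal (\<beta> \<bullet> u) - free_energy I h \<beta>)"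

definition edom :: "('v \<Rightarrow> ereal) \<Rightarrow> 'v set" where
  "edom f = {u. f u > -\<infinity>}"

text \<open>
  Concavity on the whole space of a function with values in \<open>[-\<infinity>, \<infinity>)\<close>. The functions it is
  applied to never take the value \<open>\<infinity>\<close>, so no sum \<open>\<infinity> + (-\<infinity>)\<close> arises.
\<close>
definition econcave :: "('v::real_vector \<Rightarrow> ereal) \<Rightarrow> bool" where
  "econcave f \<longleftrightarrow>
     (\<forall>u v. \<forall>t::real. 0 < t \<and> t < 1 \<longrightarrow>
        ereal t * f u + ereal (1 - t) * f v \<le> f (t *\<^sub>R u + (1 - t) *\<^sub>R v))"

definition superdifferential :: "('v::real_inner \<Rightarrow> ereal) \<Rightarrow> 'v \<Rightarrow> 'v set" where
  "superdifferential f u =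
     (if u \<in> edom f then {\<beta>. \<forall>w. f w \<le> f u + ereal (\<beta> \<bullet> (w - u))} else {})"

definition dom_superdifferential :: "('v::real_inner \<Rightarrow> ereal) \<Rightarrow> 'v set" where
  "dom_superdifferential f = {u. superdifferential f u \<noteq> {}}"

definition canonical_equilibria :: "('x \<Rightarrow> ereal) \<Rightarrow> ('x \<Rightarrow> real ^ 's) \<Rightarrow> real ^ 's \<Rightarrow> 'x set" where
  "canonical_equilibria I h \<beta> = {x. I x + ereal (\<beta> \<bullet> h x) = free_energy I h \<beta>}"

definition microcanonical_equilibria ::
    "('x \<Rightarrow> ereal) \<Rightarrow> ('x \<Rightarrow> real ^ 's) \<Rightarrow> real ^ 's \<Rightarrow> 'x set" where
  "microcanonical_equilibria I h u =
     (if u \<in> edom (micro_entropy I h) then {x. h x = u \<and> I x = - micro_entropy I h u} else {})"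

end

theory Submission
  imports Defs
begin

text \<open>
  Write \<open>s\<close> for the microcanonical entropy, \<open>\<phi>\<close> for the free energy and \<open>s\<^sup>*\<^sup>*\<close> for the hull. Minimizing
  \<open>\<beta> \<bullet> h x + I x\<close> first over a fibre of \<open>h\<close> and then over the value of \<open>h\<close> shows that a
  microcanonical equilibrium at \<open>u\<close> is a canonical equilibrium at \<open>\<beta>\<close> exactly when the affine
  function of slope \<open>\<beta>\<close> through \<open>(u, s u)\<close> lies above the graph of \<open>s\<close>. One direction of this
  correspondence is \<open>microcanonical_subset_canonical\<close>, which is part (a).

  For the other direction one needs a microcanonical equilibrium to start from: compactness of the
  level sets of \<open>I\<close> provides one over each point of \<open>edom s\<close>
  (\<open>rate_function_attains_on_closed\<close>). If it is also canonical at \<open>\<beta>\<close>, then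
  \<open>s u = \<beta> \<bullet> u - \<phi> \<beta> \<ge> s\<^sup>*\<^sup>* u\<close>. As \<open>s \<le> s\<^sup>*\<^sup>*\<close> always holds, \<open>s\<close> agrees with \<open>s\<^sup>*\<^sup>*\<close> on its domain, hence
  everywhere once the two domains agree, and \<open>s\<^sup>*\<^sup>*\<close> is concave as an infimum of affine functions.
  This is part (b), and half of (c).

  For the remaining half of (c), \<open>s\<close> is concave. Attainment also identifies each superlevel set of
  \<open>s\<close> with the continuous image of a compact set, so \<open>s\<close> is upper semicontinuous and its hypograph
  is closed and convex. Separating from it a point slightly above \<open>(u, s u)\<close> gives an affine
  majorant of \<open>s\<close>; the separating hyperplane cannot be vertical because \<open>u\<close> lies in the domain of
  \<open>s\<close>. Hence \<open>s u = s\<^sup>*\<^sup>* u\<close> on the domain (\<open>econcave_entropy_eq_hull\<close>), every supergradient of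
  \<open>s\<^sup>*\<^sup>*\<close> at such a point is one of \<open>s\<close>, and the argument of part (a) applies.
\<close>

section \<open>Affine majorants of extended-real concave functions\<close>

text \<open>
  The point \<open>(u, c)\<close> lies outside the hypograph of \<open>f\<close>, which is closed and convex. The separating
  hyperplane passes strictly between the points \<open>(u, f u)\<close> and \<open>(u, c)\<close> of a single vertical line;
  therefore it is the graph of an affine function.
\<close>
lemma econcave_affine_majorant:
  fixes f :: "'v::euclidean_space \<Rightarrow> ereal"
  assumes concave: "econcave f"
    and usc: "\<And>r::real. closed {w. ereal r \<le> f w}"
    and lt_top: "\<And>w. f w < \<infinity>"
    and u: "u \<in> edom f"
    and c: "f u < ereal c"
  obtains \<beta> where "\<And>w. f w \<le> ereal (c + \<beta> \<bullet> (w - u))"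
proof -
  define S where "S = {(w, t). ereal t \<le> f w}"
  have "open (- S)"
  proof (subst open_prod_def, intro ballI)
    fix z assume "z \<in> - S"
    then obtain w t where z: "z = (w, t)" "f w < ereal t"
      by (cases z) (auto simp: S_def not_le)
    obtain r where r: "f w < ereal r" "ereal r < ereal t"
      using ereal_dense2[OF z(2)] by blast
    have "open (- {w. ereal r \<le> f w})"
      using usc by (simp add: open_Compl)
    moreover have "open {r<..}" by simp
    moreover have "z \<in> (- {w. ereal r \<le> f w}) \<times> {r<..}"
      using r z by auto
    moreover have "(- {w. ereal r \<le> f w}) \<times> {r<..} \<subseteq> - S"
    proof
      fix y assume "y \<in> (- {w. ereal r \<le> f w}) \<times> {r<..}"
      then obtain w' t' where y: "y = (w', t')" "\<not> ereal r \<le> f w'" "ereal r < ereal t'"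
        by auto
      have lt: "f w' < ereal r" using y(2) by (simp add: not_le)
      show "y \<in> - S"
        using less_trans[OF lt y(3)] y(1) by (simp add: S_def not_le)
    qed
    ultimately show "\<exists>A B. open A \<and> open B \<and> z \<in> A \<times> B \<and> A \<times> B \<subseteq> - S"
      by blast
  qed
  then have "closed S" by (simp add: closed_def)
  moreover have "convex S"
  proof (subst convex_alt, clarsimp simp: S_def)
    fix w1 t1 w2 t2 and k :: real
    assume *: "ereal t1 \<le> f w1" "ereal t2 \<le> f w2" "0 \<le> k" "k \<le> 1"
    consider "k = 0" | "k = 1" | "0 < k" "k < 1"
      using *(3,4) by linarith
    then show "ereal ((1 - k) * t1 + k * t2) \<le> f ((1 - k) *\<^sub>R w1 + k *\<^sub>R w2)"
    proof cases
      case 3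
      have "ereal ((1 - k) * t1 + k * t2) = ereal k * ereal t2 + ereal (1 - k) * ereal t1"
        by (simp add: add.commute)
      also have "\<dots> \<le> ereal k * f w2 + ereal (1 - k) * f w1"
        using * 3 by (intro add_mono ereal_mult_left_mono) auto
      also have "\<dots> \<le> f (k *\<^sub>R w2 + (1 - k) *\<^sub>R w1)"
        using concave 3 unfolding econcave_def by blast
      finally show ?thesis by (simp add: add.commute)
    qed (use * in auto)
  qed
  moreover have "(u, c) \<notin> S"
    using c by (simp add: S_def not_le)
  ultimately obtain a b where sep: "a \<bullet> (u, c) < b" "\<And>x. x \<in> S \<Longrightarrow> b < a \<bullet> x"
    using separating_hyperplane_closed_point[of S "(u, c)"] by blast
  obtain p d where a: "a = (p, d)" by (cases a)
  have above: "p \<bullet> u + d * c < p \<bullet> w + d * t" if "ereal t \<le> f w" for w t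
    using sep(1) sep(2)[of "(w, t)"] that by (simp add: a S_def)
  obtain r where r: "f u = ereal r"
    using u lt_top[of u] by (cases "f u") (auto simp: edom_def)
  have "d * c < d * r" using above[of r u] r by simp
  then have d: "d < 0"
    using c r by (simp add: mult_less_cancel_left)
  show ?thesis
  proof (rule that[of "- (p /\<^sub>R d)"])
    fix w
    have "t \<le> c + - (p /\<^sub>R d) \<bullet> (w - u)" if "ereal t \<le> f w" for t
      using above[OF that] d by (simp add: field_simps inner_diff_right)
    then show "f w \<le> ereal (c + - (p /\<^sub>R d) \<bullet> (w - u))"
      using lt_top[of w] by (cases "f w") auto
  qed
qed

section \<open>Attainment and upper semicontinuity\<close>

text \<open>
  The sets \<open>{x \<in> C. I x \<le> r}\<close> with \<open>r\<close> above the infimum are nonempty, compact and nested, so they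
  share a point; there \<open>I\<close> equals the infimum.
\<close>
lemma rate_function_attains_on_closed:
  fixes I :: "'x::t2_space \<Rightarrow> ereal"
  assumes I: "rate_function I" and C: "closed C" and fin: "(INF x\<in>C. I x) < \<infinity>"
  obtains x where "x \<in> C" "I x = (INF x\<in>C. I x)"
proof -
  define m where "m = (INF x\<in>C. I x)"
  have "0 \<le> m"
    using I unfolding m_def rate_function_def by (auto intro: INF_greatest)
  then obtain m' where m': "m = ereal m'" "0 \<le> m'"
    using fin by (cases m) (auto simp: m_def)
  define L where "L r = C \<inter> {x. I x \<le> ereal r}" for r
  have compact: "compact (L r)" if "m' < r" for r
    using I C m' that unfolding rate_function_def L_def by (simp add: closed_Int_compact)
  have nonempty: "L r \<noteq> {}" if "m' < r" for r
  proof -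
    have "(INF x\<in>C. I x) < ereal r" using that m' m_def by simp
    then show ?thesis by (auto simp: INF_less_iff L_def intro: less_imp_le)
  qed
  have "L (m' + 1) \<inter> \<Inter> (L ` {m'<..}) \<noteq> {}"
  proof (rule compact_imp_fip)
    show "compact (L (m' + 1))" by (simp add: compact)
    show "closed T" if "T \<in> L ` {m'<..}" for T
      using that compact by (auto intro: compact_imp_closed)
    fix F assume "finite F" "F \<subseteq> L ` {m'<..}"
    then obtain R where R: "finite R" "R \<subseteq> {m'<..}" "F = L ` R"
      by (meson finite_subset_image)
    define q where "q = Min (insert (m' + 1) R)"
    have "m' < q" using R by (auto simp: q_def)
    moreover have "L q \<subseteq> L r" if "r \<in> insert (m' + 1) R" for r
    proof -
      have "q \<le> r" using that R unfolding q_def by (intro Min_le) auto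
      then show ?thesis by (auto simp: L_def intro: order_trans)
    qed
    ultimately show "L (m' + 1) \<inter> \<Inter> F \<noteq> {}"
      using nonempty[of q] R(3) by blast
  qed
  then obtain x where x: "x \<in> C" "\<And>r. m' < r \<Longrightarrow> I x \<le> ereal r"
    by (auto simp: L_def)
  have "I x \<le> m"
    unfolding m'(1) using x(2) x(2)[of "m' + 1"] by (cases "I x") (auto intro: dense_ge)
  moreover have "m \<le> I x" using x(1) by (simp add: m_def INF_lower)
  ultimately show ?thesis using that x(1) by (simp add: m_def)
qed

lemma micro_entropy_nonpos:
  assumes "rate_function I"
  shows "micro_entropy I h u \<le> 0"
proof -
  have "0 \<le> (INF x\<in>{x. h x = u}. I x)"
    using assms unfolding rate_function_def by (auto intro: INF_greatest)
  then show ?thesis by (simp add: micro_entropy_def)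
qed

lemma minus_rate_le_micro_entropy: "- I x \<le> micro_entropy I h (h x)"
  unfolding micro_entropy_def by (simp add: INF_lower)

lemma microcanonical_equilibria_iff:
  "x \<in> microcanonical_equilibria I h u \<longleftrightarrow>
    u \<in> edom (micro_entropy I h) \<and> h x = u \<and> I x = - micro_entropy I h u"
  by (simp add: microcanonical_equilibria_def)

lemma microcanonical_equilibria_nonempty:
  fixes I :: "'x::t2_space \<Rightarrow> ereal"
  assumes "rate_function I" "continuous_on UNIV h" "u \<in> edom (micro_entropy I h)"
  shows "microcanonical_equilibria I h u \<noteq> {}"
proof -
  have "closed {x. h x = u}"
    using assms(2) by (simp add: closed_Collect_eq continuous_on_const)
  moreover have "(INF x\<in>{x. h x = u}. I x) < \<infinity>"
    using assms(3) by (cases "INF x\<in>{x. h x = u}. I x") (auto simp: edom_def micro_entropy_def)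
  ultimately obtain x where "x \<in> {x. h x = u}" "I x = (INF x\<in>{x. h x = u}. I x)"
    using rate_function_attains_on_closed[OF assms(1)] by blast
  then have "x \<in> microcanonical_equilibria I h u"
    using assms(3) by (simp add: microcanonical_equilibria_iff micro_entropy_def)
  then show ?thesis by blast
qed

text \<open>
  This is upper semicontinuity of the entropy. By attainment the superlevel set at \<open>r\<close> is the image
  under \<open>h\<close> of the level set \<open>{I \<le> - r}\<close>.
\<close>
lemma closed_superlevel_micro_entropy:
  fixes I :: "'x::t2_space \<Rightarrow> ereal" and r :: real
  assumes I: "rate_function I" and h: "continuous_on UNIV h"
  shows "closed {u. ereal r \<le> micro_entropy I h u}"
proof -
  have "{u. ereal r \<le> micro_entropy I h u} = h ` {x. I x \<le> ereal (- r)}"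
  proof (intro set_eqI iffI)
    fix u assume "u \<in> {u. ereal r \<le> micro_entropy I h u}"
    then have r: "ereal r \<le> micro_entropy I h u" by simp
    then have "u \<in> edom (micro_entropy I h)" by (auto simp: edom_def)
    from microcanonical_equilibria_nonempty[OF I h this]
    obtain x where x: "h x = u" "I x = - micro_entropy I h u"
      unfolding ex_in_conv[symmetric] microcanonical_equilibria_iff by blast
    have "I x \<le> ereal (- r)"
      unfolding x(2) using r by (metis ereal_minus_le_minus uminus_ereal.simps(1))
    then show "u \<in> h ` {x. I x \<le> ereal (- r)}" using x(1) by auto
  next
    fix u assume "u \<in> h ` {x. I x \<le> ereal (- r)}"
    then obtain x where x: "u = h x" "I x \<le> ereal (- r)" by auto
    have "ereal r \<le> - I x"
      using x(2) by (cases "I x") auto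
    also have "\<dots> \<le> micro_entropy I h u"
      using minus_rate_le_micro_entropy x(1) by metis
    finally show "u \<in> {u. ereal r \<le> micro_entropy I h u}" by simp
  qed
  moreover have "compact {x. I x \<le> ereal (- r)}"
  proof (cases "0 \<le> - r")
    case True
    then show ?thesis using I unfolding rate_function_def by blast
  next
    case False
    have "\<not> I x \<le> ereal (- r)" for x
    proof
      assume "I x \<le> ereal (- r)"
      moreover have "0 \<le> I x" using I by (simp add: rate_function_def)
      ultimately have "0 \<le> ereal (- r)" by (rule order_trans[rotated])
      then show False using False by simp
    qed
    then show ?thesis by simp
  qed
  ultimately show ?thesis
    using h by (metis compact_continuous_image compact_imp_closed continuous_on_subset subset_UNIV)
qed

section \<open>Legendre--Fenchel duality\<close>

text \<open>
  An affine majorant of the entropy bounds the free energy from below, because every \<open>x\<close> lies in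
  the fibre of \<open>h\<close> over its own image.
\<close>
lemma free_energy_ge_if_affine_majorant:
  assumes "\<And>w. micro_entropy I h w \<le> ereal (c + \<beta> \<bullet> (w - u))"
  shows "ereal (\<beta> \<bullet> u - c) \<le> free_energy I h \<beta>"
  unfolding free_energy_def
proof (rule INF_greatest)
  fix x
  have "- I x \<le> ereal (c + \<beta> \<bullet> (h x - u))"
    by (rule order_trans[OF minus_rate_le_micro_entropy assms])
  then show "ereal (\<beta> \<bullet> u - c) \<le> ereal (\<beta> \<bullet> h x) + I x"
    by (cases "I x") (auto simp: inner_diff_right)
qed

lemma micro_entropy_le_entropy_hull: "micro_entropy I h u \<le> entropy_hull I h u"
  unfolding entropy_hull_def
proof (rule INF_greatest)
  fix \<beta>
  have "free_energy I h \<beta> - ereal (\<beta> \<bullet> u) \<le> (INF x\<in>{x. h x = u}. I x)"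
  proof (rule INF_greatest)
    fix x assume "x \<in> {x. h x = u}"
    then have "free_energy I h \<beta> \<le> ereal (\<beta> \<bullet> u) + I x"
      unfolding free_energy_def by (auto intro: INF_lower2)
    then show "free_energy I h \<beta> - ereal (\<beta> \<bullet> u) \<le> I x"
      by (cases "I x"; cases "free_energy I h \<beta>") auto
  qed
  then show "micro_entropy I h u \<le> ereal (\<beta> \<bullet> u) - free_energy I h \<beta>"
    unfolding micro_entropy_def
    by (cases "free_energy I h \<beta>"; cases "INF x\<in>{x. h x = u}. I x") auto
qed

lemma econcave_entropy_hull: "econcave (entropy_hull I h)"
  unfolding econcave_def
proof (intro allI impI)
  fix u v and t :: real assume t: "0 < t \<and> t < 1"
  show "ereal t * entropy_hull I h u + ereal (1 - t) * entropy_hull I h v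
      \<le> entropy_hull I h (t *\<^sub>R u + (1 - t) *\<^sub>R v)"
    unfolding entropy_hull_def[of I h "t *\<^sub>R u + (1 - t) *\<^sub>R v"]
  proof (rule INF_greatest)
    fix \<beta>
    have "entropy_hull I h w \<le> ereal (\<beta> \<bullet> w) - free_energy I h \<beta>" for w
      unfolding entropy_hull_def by (rule INF_lower) simp
    then have "ereal t * entropy_hull I h u + ereal (1 - t) * entropy_hull I h v
        \<le> ereal t * (ereal (\<beta> \<bullet> u) - free_energy I h \<beta>)
          + ereal (1 - t) * (ereal (\<beta> \<bullet> v) - free_energy I h \<beta>)"
      using t by (intro add_mono ereal_mult_left_mono) auto
    also have "\<dots> \<le> ereal (\<beta> \<bullet> (t *\<^sub>R u + (1 - t) *\<^sub>R v)) - free_energy I h \<beta>"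
      using t by (cases "free_energy I h \<beta>") (auto simp: inner_add_right algebra_simps)
    finally show "ereal t * entropy_hull I h u + ereal (1 - t) * entropy_hull I h v
        \<le> ereal (\<beta> \<bullet> (t *\<^sub>R u + (1 - t) *\<^sub>R v)) - free_energy I h \<beta>" .
  qed
qed

text \<open>
  The affine majorants of \<open>s\<close> that pass through \<open>(u, c)\<close>, with \<open>c\<close> arbitrarily close to \<open>s u\<close>,
  bring \<open>s\<^sup>*\<^sup>* u\<close> down to \<open>s u\<close>.
\<close>
lemma econcave_entropy_eq_hull:
  fixes I :: "'x::t2_space \<Rightarrow> ereal"
  assumes I: "rate_function I" and h: "continuous_on UNIV h"
    and concave: "econcave (micro_entropy I h)"
    and u: "u \<in> edom (micro_entropy I h)"
  shows "micro_entropy I h u = entropy_hull I h u"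
proof (rule antisym[OF micro_entropy_le_entropy_hull dense_ge])
  fix c assume c: "micro_entropy I h u < c"
  show "entropy_hull I h u \<le> c"
  proof (cases c)
    case (real r)
    have "micro_entropy I h w < \<infinity>" for w
      using micro_entropy_nonpos[OF I, of h w] by (rule le_less_trans) simp
    then obtain \<beta> where "\<And>w. micro_entropy I h w \<le> ereal (r + \<beta> \<bullet> (w - u))"
      using econcave_affine_majorant[OF concave closed_superlevel_micro_entropy[OF I h] _ u] c real
      by blast
    then have "ereal (\<beta> \<bullet> u - r) \<le> free_energy I h \<beta>"
      by (rule free_energy_ge_if_affine_majorant)
    then have "ereal (\<beta> \<bullet> u) - free_energy I h \<beta> \<le> c"
      using real by (cases "free_energy I h \<beta>") auto
    then show ?thesis
      unfolding entropy_hull_def by (rule INF_lower2[OF UNIV_I])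
  qed (use c in auto)
qed

section \<open>Equilibrium macrostates and supporting hyperplanes\<close>

lemma superdifferentialD:
  assumes "\<beta> \<in> superdifferential f u"
  shows "f w \<le> f u + ereal (\<beta> \<bullet> (w - u))"
proof (cases "u \<in> edom f")
  case True
  with assms show ?thesis
    unfolding superdifferential_def if_P[OF True] by blast
next
  case False
  with assms show ?thesis
    unfolding superdifferential_def if_not_P[OF False] by blast
qed

text \<open>
  The supporting hyperplane at \<open>u\<close> bounds \<open>\<phi> \<beta>\<close> below by \<open>\<beta> \<bullet> u - s u\<close>, and a microcanonical
  equilibrium at \<open>u\<close> realizes this value.
\<close>
lemma microcanonical_subset_canonical:
  assumes I: "rate_function I" and \<beta>: "\<beta> \<in> superdifferential (micro_entropy I h) u"
  shows "microcanonical_equilibria I h u \<subseteq> canonical_equilibria I h \<beta>"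
proof
  fix x assume "x \<in> microcanonical_equilibria I h u"
  then have x: "h x = u" "I x = - micro_entropy I h u" and u: "u \<in> edom (micro_entropy I h)"
    unfolding microcanonical_equilibria_iff by blast+
  obtain r where r: "micro_entropy I h u = ereal r"
    using u micro_entropy_nonpos[OF I, of h u]
    by (cases "micro_entropy I h u") (auto simp: edom_def)
  have "micro_entropy I h w \<le> ereal (r + \<beta> \<bullet> (w - u))" for w
    using superdifferentialD[OF \<beta>, of w] by (simp only: r plus_ereal.simps)
  then have "ereal (\<beta> \<bullet> u - r) \<le> free_energy I h \<beta>"
    by (rule free_energy_ge_if_affine_majorant)
  moreover have "I x + ereal (\<beta> \<bullet> h x) = ereal (\<beta> \<bullet> u - r)"
    unfolding x r by simp
  moreover have "free_energy I h \<beta> \<le> I x + ereal (\<beta> \<bullet> h x)"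
    unfolding free_energy_def by (subst add.commute) (rule INF_lower, simp)
  ultimately show "x \<in> canonical_equilibria I h \<beta>"
    unfolding canonical_equilibria_def mem_Collect_eq by (metis antisym)
qed

text \<open>
  A common element \<open>x\<close> of the two sets of equilibria turns the inequality \<open>s u \<le> \<beta> \<bullet> u - \<phi> \<beta>\<close> into
  an equality, so the infimum defining \<open>s\<^sup>*\<^sup>* u\<close> is at most \<open>s u\<close>.
\<close>
lemma entropy_eq_hull_if_microcanonical_subset_canonical:
  fixes I :: "'x::t2_space \<Rightarrow> ereal"
  assumes I: "rate_function I" and h: "continuous_on UNIV h"
    and u: "u \<in> edom (micro_entropy I h)"
    and sub: "microcanonical_equilibria I h u \<subseteq> canonical_equilibria I h \<beta>"
  shows "micro_entropy I h u = entropy_hull I h u"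
proof (rule antisym[OF micro_entropy_le_entropy_hull])
  obtain x where "x \<in> microcanonical_equilibria I h u" "x \<in> canonical_equilibria I h \<beta>"
    using microcanonical_equilibria_nonempty[OF I h u] sub by blast
  then have x: "h x = u" "I x = - micro_entropy I h u" "I x + ereal (\<beta> \<bullet> h x) = free_energy I h \<beta>"
    unfolding microcanonical_equilibria_iff canonical_equilibria_def by blast+
  have "entropy_hull I h u \<le> ereal (\<beta> \<bullet> u) - free_energy I h \<beta>"
    unfolding entropy_hull_def by (rule INF_lower) simp
  also have "\<dots> = micro_entropy I h u"
    unfolding x(3)[symmetric] x(1,2) by (cases "micro_entropy I h u") auto
  finally show "entropy_hull I h u \<le> micro_entropy I h u" .
qed

lemma econcave_if_microcanonical_subset_canonical:
  fixes I :: "'x::t2_space \<Rightarrow> ereal"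
  assumes I: "rate_function I" and h: "continuous_on UNIV h"
    and dom: "edom (micro_entropy I h) = edom (entropy_hull I h)"
    and sub: "\<And>u. u \<in> edom (micro_entropy I h) \<Longrightarrow>
      \<exists>\<beta>. microcanonical_equilibria I h u \<subseteq> canonical_equilibria I h \<beta>"
  shows "econcave (micro_entropy I h)"
proof -
  have "micro_entropy I h u = entropy_hull I h u" for u
  proof (cases "u \<in> edom (micro_entropy I h)")
    case True
    then show ?thesis
      using sub entropy_eq_hull_if_microcanonical_subset_canonical[OF I h] by blast
  next
    case False
    then have "u \<notin> edom (entropy_hull I h)" by (simp add: dom)
    with False show ?thesis by (simp add: edom_def)
  qed
  then have "micro_entropy I h = entropy_hull I h" by (rule ext)
  then show ?thesis by (simp add: econcave_entropy_hull)
qed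

lemma superdifferential_hull_subset_entropy:
  assumes "u \<in> edom (micro_entropy I h)" "micro_entropy I h u = entropy_hull I h u"
  shows "superdifferential (entropy_hull I h) u \<subseteq> superdifferential (micro_entropy I h) u"
proof
  fix \<beta> assume \<beta>: "\<beta> \<in> superdifferential (entropy_hull I h) u"
  have "micro_entropy I h w \<le> micro_entropy I h u + ereal (\<beta> \<bullet> (w - u))" for w
  proof (rule order_trans[OF micro_entropy_le_entropy_hull])
    show "entropy_hull I h w \<le> micro_entropy I h u + ereal (\<beta> \<bullet> (w - u))"
      unfolding assms(2) by (rule superdifferentialD[OF \<beta>])
  qed
  then show "\<beta> \<in> superdifferential (micro_entropy I h) u"
    unfolding superdifferential_def if_P[OF assms(1)] by blast
qed

theorem theorem4p9:
  fixes P :: "nat \<Rightarrow> 'w measure"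
    and H :: "nat \<Rightarrow> 's::finite \<Rightarrow> 'w \<Rightarrow> real"
    and a :: "nat \<Rightarrow> real"
    and Y :: "nat \<Rightarrow> 'w \<Rightarrow> 'x::polish_space"
    and h :: "'x \<Rightarrow> real ^ 's"
    and I :: "'x \<Rightarrow> ereal"
  assumes "\<And>n. prob_space (P n)"
    and "\<And>n i. H n i \<in> borel_measurable (P n)"
    and "\<And>n i. bounded (H n i ` space (P n))"
    and "\<And>n. 0 < a n"
    and "filterlim a at_top sequentially"
    and "\<And>n. Y n \<in> measurable (P n) borel"
    and "\<And>i. continuous_on UNIV (\<lambda>x. h x $ i)"
    and "\<And>i. bounded (range (\<lambda>x. h x $ i))"
    and "\<And>i. (\<lambda>n. SUP \<omega>\<in>space (P n). \<bar>H n i \<omega> - h (Y n \<omega>) $ i\<bar>) \<longlonglongrightarrow> 0"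
    and "large_deviation_principle P Y a I"
  defines "s \<equiv> micro_entropy I h"
    and "ss \<equiv> entropy_hull I h"
  shows "(econcave s \<longrightarrow>
            (\<forall>u\<in>dom_superdifferential s. \<exists>\<beta>\<in>superdifferential s u.
               microcanonical_equilibria I h u \<subseteq> canonical_equilibria I h \<beta>)) \<and>
         (edom s = edom ss \<and>
          (\<forall>u\<in>edom s. \<exists>\<beta>. microcanonical_equilibria I h u \<subseteq> canonical_equilibria I h \<beta>)
            \<longrightarrow> econcave s) \<and>
         (edom s = edom ss \<and> edom ss = dom_superdifferential ss \<longrightarrow>
            (econcave s \<longleftrightarrow>
             (\<forall>u\<in>edom s. \<exists>\<beta>. microcanonical_equilibria I h u \<subseteq> canonical_equilibria I h \<beta>)))"
proof (intro conjI impI ballI)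
  have I: "rate_function I"
    using assms(10) by (simp add: large_deviation_principle_def)
  have "continuous_on UNIV (\<lambda>x. \<chi> i. h x $ i)"
    by (intro continuous_on_vec_lambda assms(7))
  then have h: "continuous_on UNIV h" by simp
  have from_subset: "econcave s"
    if "edom s = edom ss"
      "\<forall>u\<in>edom s. \<exists>\<beta>. microcanonical_equilibria I h u \<subseteq> canonical_equilibria I h \<beta>"
    using econcave_if_microcanonical_subset_canonical[OF I h] that unfolding s_def ss_def by blast
  show "\<exists>\<beta>\<in>superdifferential s u.
      microcanonical_equilibria I h u \<subseteq> canonical_equilibria I h \<beta>"
    if "u \<in> dom_superdifferential s" for u
    using that microcanonical_subset_canonical[OF I]
    unfolding s_def dom_superdifferential_def by blast
  show "econcave s"
    if "edom s = edom ss \<and>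
      (\<forall>u\<in>edom s. \<exists>\<beta>. microcanonical_equilibria I h u \<subseteq> canonical_equilibria I h \<beta>)"
    using from_subset that by blast
  assume dom: "edom s = edom ss \<and> edom ss = dom_superdifferential ss"
  show "econcave s \<longleftrightarrow>
      (\<forall>u\<in>edom s. \<exists>\<beta>. microcanonical_equilibria I h u \<subseteq> canonical_equilibria I h \<beta>)"
  proof (intro iffI ballI)
    fix u assume concave: "econcave s" and u: "u \<in> edom s"
    have "u \<in> dom_superdifferential ss"
      using dom u by blast
    then obtain \<beta> where "\<beta> \<in> superdifferential ss u"
      unfolding dom_superdifferential_def by blast
    moreover have "s u = ss u"
      using econcave_entropy_eq_hull[OF I h] concave u unfolding s_def ss_def by blast
    ultimately have "\<beta> \<in> superdifferential s u"
      using superdifferential_hull_subset_entropy u unfolding s_def ss_def by blast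
    then show "\<exists>\<beta>. microcanonical_equilibria I h u \<subseteq> canonical_equilibria I h \<beta>"
      using microcanonical_subset_canonical[OF I] unfolding s_def by blast
  next
    assume "\<forall>u\<in>edom s. \<exists>\<beta>.
      microcanonical_equilibria I h u \<subseteq> canonical_equilibria I h \<beta>"
    with from_subset dom show "econcave s" by blast
  qed
qed

end
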